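(* For every integer $n\geq 2$ we have $C_{\mathbb Z_n',\{1\}}(n)=4$.
   Context: $\mathbb Z_n=\mathbb Z/n\mathbb Z$ as a module over itself and $\mathbb Z_n'=\mathbb Z_n\setminus\{0\}$. For non-empty $A,B\subseteq\mathbb Z_n$, a sequence $(x_1,\ldots,x_k)$ is an $(A,B)$-weighted zero-sum sequence if there exist $a_i\in A$, $b_i\in B$ with $\sum a_ix_i=0$ and $\sum b_ia_i=0$. $C_{A,B}(n)$ is the least positive $k$ such that every sequence in $\mathbb Z_n$ of length $k$ has an $(A,B)$-weighted zero-sum subsequence having consecutive terms, i.e. a non-empty block $(x_i,\ldots,x_j)$. *)

theory Defs
  imports "HOL-Number_Theory.Cong" "HOL-Library.Sublist"
begin

text \<open>The ring of integers modulo \<open>n\<close> is represented by the least nonnegative residues, with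
  equations in it read as congruences; \<open>n\<close> is meant to be positive.\<close>

definition Zn :: "int \<Rightarrow> int set" where
  "Zn n = {0..<n}"

definition Zn_nonzero :: "int \<Rightarrow> int set" where
  "Zn_nonzero n = Zn n - {0}"

definition weighted_zero_sum :: "int \<Rightarrow> int set \<Rightarrow> int set \<Rightarrow> int list \<Rightarrow> bool" where
  "weighted_zero_sum n A B xs \<longleftrightarrow>
     (\<exists>as bs. length as = length xs \<and> length bs = length xs \<and> set as \<subseteq> A \<and> set bs \<subseteq> B \<and>
        [(\<Sum>i<length xs. as ! i * xs ! i) = 0] (mod n) \<and>
        [(\<Sum>i<length xs. bs ! i * as ! i) = 0] (mod n))"

text \<open>\<^const>\<open>sublist\<close> is the contiguous sublist relation. The constant is meant for nonempty
  \<open>A, B \<subseteq> Zn n\<close>. As \<open>Inf {} = 0\<close> on natural numbers, a positive value of the constant is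
  the least element of the set below, which is then nonempty.\<close>

definition C_const :: "int set \<Rightarrow> int set \<Rightarrow> int \<Rightarrow> nat" where
  "C_const A B n = Inf {k. 0 < k \<and>
     (\<forall>xs. length xs = k \<and> set xs \<subseteq> Zn n \<longrightarrow>
        (\<exists>ys. ys \<noteq> [] \<and> sublist ys xs \<and> weighted_zero_sum n A B ys))}"

end

theory Submission
  imports Defs
begin

text \<open>The sequence \<open>(0, 1, 0)\<close> shows that three terms are not enough. Among four
  terms, equal neighbours \<open>x, x\<close> take the weights \<open>(1, -1)\<close>, and consecutive
  distinct \<open>x, y, z\<close> take the weights \<open>(z - y, x - z, y - x)\<close>. A sequence of four terms
  without such a block is \<open>(x, y, x, y)\<close>, which takes the weights \<open>(1, 1, -1, -1)\<close>.\<close>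

text \<open>Allows weights that are arbitrary integers not divisible by \<open>n\<close>, such as
  \<open>-1\<close> or a difference of terms, in place of residues in \<open>Zn_nonzero n\<close>.
  Reducing each weight modulo \<open>n\<close> changes each summand only by a multiple of
  \<open>n\<close>, so both sums stay divisible by \<open>n\<close>.\<close>

lemma weighted_zero_sumI:
  fixes n :: int
  assumes "n > 0" "length as = length xs" "\<And>a. a \<in> set as \<Longrightarrow> \<not> n dvd a"
    and ax: "n dvd (\<Sum>i<length xs. as ! i * xs ! i)"
    and a: "n dvd (\<Sum>i<length xs. as ! i)"
  shows "weighted_zero_sum n (Zn_nonzero n) {1} xs"
proof -
  let ?as = "map (\<lambda>a. a mod n) as" and ?bs = "map (\<lambda>_. 1 :: int) xs"
  have "set ?as \<subseteq> Zn_nonzero n"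
    using assms(1,3) by (auto simp: Zn_nonzero_def Zn_def dvd_eq_mod_eq_0)
  moreover have "[(\<Sum>i<length xs. ?as ! i * xs ! i) = (\<Sum>i<length xs. as ! i * xs ! i)] (mod n)"
    using assms(2) by (intro cong_sum cong_mult) (auto simp: cong_def)
  then have "[(\<Sum>i<length xs. ?as ! i * xs ! i) = 0] (mod n)"
    using ax cong_0_iff cong_trans by blast
  moreover have "[(\<Sum>i<length xs. ?bs ! i * ?as ! i) = (\<Sum>i<length xs. as ! i)] (mod n)"
    using assms(2) by (intro cong_sum) (auto simp: cong_def)
  then have "[(\<Sum>i<length xs. ?bs ! i * ?as ! i) = 0] (mod n)"
    using a cong_0_iff cong_trans by blast
  moreover have "length ?as = length xs" "length ?bs = length xs" "set ?bs \<subseteq> {1}"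
    using assms(2) by auto
  ultimately show ?thesis
    unfolding weighted_zero_sum_def by blast
qed

lemma not_dvd_diff_Zn:
  assumes "x \<in> Zn n" "y \<in> Zn n" "x \<noteq> y"
  shows "\<not> n dvd x - y"
  using assms by (auto simp: Zn_def mod_eq_dvd_iff[symmetric])

lemma weighted_zero_sum_pair:
  assumes "n \<ge> 2"
  shows "weighted_zero_sum n (Zn_nonzero n) {1} [x, x]"
  \<comment> \<open>The weights 1 and -1 are admissible because no \<open>n >= 2\<close> divides
    either of them.\<close>
  using assms by (intro weighted_zero_sumI[where as = "[1, -1]"]) (auto simp: zdvd1_eq)

text \<open>The weights form the cross product of (1, 1, 1) and (x, y, z). It is orthogonal to both
  factors, so both sums vanish already over the integers; distinctness serves to make each weight
  non-zero modulo \<open>n\<close>.\<close>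

lemma weighted_zero_sum_distinct:
  assumes "n \<ge> 2" "{x, y, z} \<subseteq> Zn n" "distinct [x, y, z]"
  shows "weighted_zero_sum n (Zn_nonzero n) {1} [x, y, z]"
proof (rule weighted_zero_sumI[where as = "[z - y, x - z, y - x]"])
  show "\<not> n dvd a" if "a \<in> set [z - y, x - z, y - x]" for a
    using that assms by (auto simp: not_dvd_diff_Zn)
qed (use assms(1) in \<open>auto simp: lessThan_Suc algebra_simps eval_nat_numeral\<close>)

lemma weighted_zero_sum_alternating:
  assumes "n \<ge> 2"
  shows "weighted_zero_sum n (Zn_nonzero n) {1} [x, y, x, y]"
  using assms
  by (intro weighted_zero_sumI[where as = "[1, 1, -1, -1]"]) (auto simp: zdvd1_eq lessThan_Suc)

lemma length_four_has_weighted_zero_sum_block: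
  assumes "n \<ge> 2" "length xs = 4" "set xs \<subseteq> Zn n"
  shows "\<exists>ys. ys \<noteq> [] \<and> sublist ys xs \<and> weighted_zero_sum n (Zn_nonzero n) {1} ys"
proof -
  obtain a b c d where xs: "xs = [a, b, c, d]"
    using assms(2) by (auto simp: length_Suc_conv eval_nat_numeral)
  have sub: "sublist [a, b] xs" "sublist [b, c] xs" "sublist [c, d] xs"
    "sublist [a, b, c] xs" "sublist [b, c, d] xs"
    unfolding xs by (simp_all add: sublist_Cons_right)
  \<comment> \<open>If neighbours always differ, a triple of consecutive terms can fail to be
    distinct only when its outer terms agree. If this happens for both triples, then
    \<open>c = a\<close> and \<open>d = b\<close>.\<close>
  consider "a = b" | "b = c" | "c = d" | "distinct [a, b, c]" | "distinct [b, c, d]"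
    | "c = a" "d = b"
    by auto
  then show ?thesis
  proof cases
    case 1
    then show ?thesis using sub(1) weighted_zero_sum_pair[OF assms(1)] by blast
  next
    case 2
    then show ?thesis using sub(2) weighted_zero_sum_pair[OF assms(1)] by blast
  next
    case 3
    then show ?thesis using sub(3) weighted_zero_sum_pair[OF assms(1)] by blast
  next
    case 4
    then have "weighted_zero_sum n (Zn_nonzero n) {1} [a, b, c]"
      using assms xs by (intro weighted_zero_sum_distinct) auto
    then show ?thesis using sub(4) by blast
  next
    case 5
    then have "weighted_zero_sum n (Zn_nonzero n) {1} [b, c, d]"
      using assms xs by (intro weighted_zero_sum_distinct) auto
    then show ?thesis using sub(5) by blast
  next
    case 6
    then show ?thesis using weighted_zero_sum_alternating[OF assms(1)] xs by blast
  qed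
qed

text \<open>In a block that contains the 1, the first sum reduces to the weight of that 1. The only
  other non-empty block is \<open>[0]\<close>, whose second sum is its single weight. Neither can be
  0 modulo \<open>n\<close>, since weights lie strictly between 0 and \<open>n\<close>.\<close>

lemma not_weighted_zero_sum_010:
  assumes "ys \<noteq> []" "sublist ys [0, 1, 0]"
  shows "\<not> weighted_zero_sum n (Zn_nonzero n) {1} ys"
proof
  assume "weighted_zero_sum n (Zn_nonzero n) {1} ys"
  then obtain as bs where as: "length as = length ys" "set as \<subseteq> Zn_nonzero n"
    and bs: "length bs = length ys" "set bs \<subseteq> {1}"
    and ax: "[(\<Sum>i<length ys. as ! i * ys ! i) = 0] (mod n)"
    and ba: "[(\<Sum>i<length ys. bs ! i * as ! i) = 0] (mod n)"
    unfolding weighted_zero_sum_def by blast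
  have nz: "\<not> [a = 0] (mod n)" if "a \<in> set as" for a
    using subsetD[OF as(2) that] zdvd_not_zless[of a n]
    by (auto simp: Zn_nonzero_def Zn_def cong_0_iff)
  have "ys \<in> {[0], [1], [0, 1], [1, 0], [0, 1, 0]}"
    using assms by (auto simp: sublist_Cons_right prefix_Cons)
  then consider "ys = [0]" | "ys = [1]" | "ys = [0, 1]" | "ys = [1, 0]" | "ys = [0, 1, 0]"
    by blast
  then show False
    using as(1) bs ax ba nz by cases (auto simp: length_Suc_conv lessThan_Suc)
qed

theorem theorem6:
  fixes n :: int
  assumes "n \<ge> 2"
  shows "C_const (Zn_nonzero n) {1} n = 4"
  unfolding C_const_def
proof (rule cInf_eq_minimum)
  show "4 \<in> {k. 0 < k \<and> (\<forall>xs. length xs = k \<and> set xs \<subseteq> Zn n \<longrightarrow>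
      (\<exists>ys. ys \<noteq> [] \<and> sublist ys xs \<and> weighted_zero_sum n (Zn_nonzero n) {1} ys))}"
    using length_four_has_weighted_zero_sum_block[OF assms] by simp
next
  fix k
  assume "k \<in> {k. 0 < k \<and> (\<forall>xs. length xs = k \<and> set xs \<subseteq> Zn n \<longrightarrow>
      (\<exists>ys. ys \<noteq> [] \<and> sublist ys xs \<and> weighted_zero_sum n (Zn_nonzero n) {1} ys))}"
  then have k: "\<And>xs. length xs = k \<Longrightarrow> set xs \<subseteq> Zn n \<Longrightarrow>
      \<exists>ys. ys \<noteq> [] \<and> sublist ys xs \<and> weighted_zero_sum n (Zn_nonzero n) {1} ys"
    by blast
  show "4 \<le> k"
  proof (rule ccontr)
    assume "\<not> 4 \<le> k"
    \<comment> \<open>Prefixes of one sequence refute all smaller lengths at once, because a block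
      of a prefix is also a block of \<open>[0, 1, 0]\<close>.\<close>
    then have "length (take k [0, 1, 0 :: int]) = k"
      by simp
    moreover have "set (take k [0, 1, 0]) \<subseteq> Zn n"
      using assms set_take_subset[of k "[0, 1, 0 :: int]"] by (auto simp: Zn_def)
    ultimately obtain ys where "ys \<noteq> []" "sublist ys (take k [0, 1, 0])"
        "weighted_zero_sum n (Zn_nonzero n) {1} ys"
      using k by blast
    then show False
      using not_weighted_zero_sum_010 sublist_order.order.trans sublist_take by blast
  qed
qed

end
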